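(* Let $p$ be an odd prime, $k\ge 1$, $n\ge 2$, and let $V$ be an $n$-dimensional vector space over the finite field $\mathbb{F}_{p^k}$. Consider all products $\cdot$ on $V$ such that $(V,+,\cdot)$ is a commutative, $3$-nilpotent $\mathbb{F}_{p^k}$-algebra, $V\cdot V$ is a one-dimensional subspace of $V$, and $\mathrm{Ann}(V)=V\cdot V$. Then, up to isomorphism of $\mathbb{F}_{p^k}$-algebras, there are exactly two such algebras if $n-1$ is even, and exactly one such algebra if $n-1$ is odd.
   Context: Algebras are associative, not necessarily unital, with $\mathbb{F}_{p^k}$-bilinear product. "$3$-nilpotent" means $V^3=0$, i.e. $x\cdot y\cdot z=0$ for all $x,y,z\in V$. $V\cdot V$ denotes the linear span of all products $x\cdot y$, and $\mathrm{Ann}(V)=\{a\in V\mid a\cdot x=0 \text{ for all } x\in V\}$. *)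

theory Defs
  imports Complex_Main "HOL-Library.Cardinality" "HOL-Computational_Algebra.Primes"
begin

text \<open>
  The vector space is a whole type with an explicit scalar multiplication \<open>scale\<close>; an algebra
  structure on it is given by its product alone.
\<close>

definition algebra_product ::
    "('f::field \<Rightarrow> 'v::ab_group_add \<Rightarrow> 'v) \<Rightarrow> ('v \<Rightarrow> 'v \<Rightarrow> 'v) \<Rightarrow> bool" where
  "algebra_product scale m \<longleftrightarrow>
     (\<forall>x. Vector_Spaces.linear scale scale (\<lambda>y. m x y)) \<and>
     (\<forall>y. Vector_Spaces.linear scale scale (\<lambda>x. m x y)) \<and>
     (\<forall>x y z. m (m x y) z = m x (m y z))"

definition commutative_product :: "('v \<Rightarrow> 'v \<Rightarrow> 'v) \<Rightarrow> bool" where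
  "commutative_product m \<longleftrightarrow> (\<forall>x y. m x y = m y x)"

text \<open>The bracketing is immaterial, since the notion is only used for associative products.\<close>

definition three_nilpotent :: "('v::zero \<Rightarrow> 'v \<Rightarrow> 'v) \<Rightarrow> bool" where
  "three_nilpotent m \<longleftrightarrow> (\<forall>x y z. m (m x y) z = 0)"

definition square_space ::
    "('f::field \<Rightarrow> 'v::ab_group_add \<Rightarrow> 'v) \<Rightarrow> ('v \<Rightarrow> 'v \<Rightarrow> 'v) \<Rightarrow> 'v set" where
  "square_space scale m = module.span scale {m x y | x y. True}"

definition annihilator :: "('v::zero \<Rightarrow> 'v \<Rightarrow> 'v) \<Rightarrow> 'v set" where
  "annihilator m = {a. \<forall>x. m a x = 0}"

definition admissible_products ::
    "('f::field \<Rightarrow> 'v::ab_group_add \<Rightarrow> 'v) \<Rightarrow> ('v \<Rightarrow> 'v \<Rightarrow> 'v) set" where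
  "admissible_products scale =
     {m. algebra_product scale m \<and> commutative_product m \<and> three_nilpotent m \<and>
         vector_space.dim scale (square_space scale m) = 1 \<and>
         annihilator m = square_space scale m}"

definition algebra_isomorphic ::
    "('f::field \<Rightarrow> 'v::ab_group_add \<Rightarrow> 'v) \<Rightarrow> ('v \<Rightarrow> 'v \<Rightarrow> 'v) \<Rightarrow> ('v \<Rightarrow> 'v \<Rightarrow> 'v) \<Rightarrow> bool" where
  "algebra_isomorphic scale m m' \<longleftrightarrow>
     (\<exists>f. Vector_Spaces.linear scale scale f \<and> bij f \<and> (\<forall>x y. f (m x y) = m' (f x) (f y)))"

definition iso_rel ::
    "('f::field \<Rightarrow> 'v::ab_group_add \<Rightarrow> 'v) \<Rightarrow> (('v \<Rightarrow> 'v \<Rightarrow> 'v) \<times> ('v \<Rightarrow> 'v \<Rightarrow> 'v)) set" where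
  "iso_rel scale =
     {(m, m'). m \<in> admissible_products scale \<and> m' \<in> admissible_products scale \<and>
               algebra_isomorphic scale m m'}"

lemma algebra_isomorphic_refl:
  assumes "vector_space scale"
  shows "algebra_isomorphic scale m m"
  unfolding algebra_isomorphic_def
  by (rule exI[of _ id]) (simp add: vector_space.linear_id[OF assms])

lemma algebra_isomorphic_sym:
  assumes "algebra_isomorphic scale m m'"
  shows "algebra_isomorphic scale m' m"
proof -
  obtain f where f: "Vector_Spaces.linear scale scale f" "bij f"
    and hom: "\<And>x y. f (m x y) = m' (f x) (f y)"
    using assms unfolding algebra_isomorphic_def by blast
  interpret f: Vector_Spaces.linear scale scale f by (fact f(1))
  have f_inv: "f (inv f x) = x" and inv_f: "inv f (f x) = x" for x
    using f(2) by (simp_all add: bij_is_surj surj_f_inv_f bij_is_inj)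
  have "Vector_Spaces.linear scale scale (inv f)"
    by unfold_locales (metis f.add f_inv inv_f, metis f.scale f_inv inv_f)
  moreover have "inv f (m' x y) = m (inv f x) (inv f y)" for x y
    by (metis hom f_inv inv_f)
  ultimately show ?thesis
    using bij_imp_bij_inv[OF f(2)] unfolding algebra_isomorphic_def by blast
qed

lemma algebra_isomorphic_trans:
  assumes "algebra_isomorphic scale m m'" "algebra_isomorphic scale m' m''"
  shows "algebra_isomorphic scale m m''"
proof -
  obtain f g where "Vector_Spaces.linear scale scale f" "bij f"
    "\<And>x y. f (m x y) = m' (f x) (f y)"
    "Vector_Spaces.linear scale scale g" "bij g" "\<And>x y. g (m' x y) = m'' (g x) (g y)"
    using assms unfolding algebra_isomorphic_def by blast
  then show ?thesis
    unfolding algebra_isomorphic_def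
    by (intro exI[of _ "g \<circ> f"]) (auto intro: Vector_Spaces.linear_compose bij_comp)
qed

lemma equiv_iso_rel:
  assumes "vector_space scale"
  shows "equiv (admissible_products scale) (iso_rel scale)"
  by (rule equivI)
    (auto simp: iso_rel_def refl_on_def sym_def trans_def algebra_isomorphic_refl[OF assms]
      intro: algebra_isomorphic_sym algebra_isomorphic_trans)

end

theory Submission
  imports Defs "HOL-Number_Theory.Residues" "Jordan_Normal_Form.Determinant"
begin

text \<open>
  A choice of a vector \<open>z\<close> spanning the line \<open>V \<cdot> V\<close> turns the product into a symmetric bilinear form:
  \<open>x \<cdot> y = B x y z\<close>, and \<open>Ann(V) = V \<cdot> V\<close> says that the radical of \<open>B\<close> is exactly this line. So \<open>B\<close> has
  rank \<open>n - 1\<close>. Another choice of \<open>z\<close> multiplies \<open>B\<close> by a nonzero scalar. The algebras are therefore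
  classified by nondegenerate symmetric forms of rank \<open>n - 1\<close> up to congruence and scaling.

  Over a finite field of odd order, every nondegenerate binary form represents \<open>1\<close>, so a form of
  rank \<open>n - 1\<close> has the diagonal shape \<open>\<langle>1, \<dots>, 1, d\<rangle>\<close> (\<open>normal_frame_exists\<close>). The entry \<open>d\<close> matters only
  up to squares, and there are two classes of nonzero elements modulo squares. This gives at most two
  algebras.

  The class of \<open>d\<close> is the discriminant. A change of basis multiplies it by the square of a determinant,
  and scaling the form by \<open>c\<close> multiplies it by \<open>c ^ (n - 1)\<close> (\<open>diagonal_frames_discriminant\<close>). If
  \<open>n - 1\<close> is even, this factor is a square and the two algebras are not isomorphic
  (\<open>not_isomorphic_if_even_rank\<close>). If \<open>n - 1\<close> is odd, scaling by \<open>d\<close> makes the discriminant a square and only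
  one algebra is left (\<open>normal_frame_1_if_odd_rank\<close>). Both discriminants occur
  (\<open>diagonal_product_exists\<close>).
\<close>

section \<open>Squares in a finite field of odd order\<close>

lemma two_neq_0_if_odd_CARD:
  assumes "odd CARD('f)"
  shows "(2 :: 'f :: {field,finite}) \<noteq> 0"
proof
  assume "(2 :: 'f) = 0"
  then have "of_nat 2 = (0 :: 'f)" by simp
  then have "CHAR('f) dvd 2" by (simp only: of_nat_eq_0_iff_char_dvd)
  moreover have "CHAR('f) \<noteq> 1" using CHAR_not_1[where 'a = 'f] by simp
  ultimately have "CHAR('f) = 2" using prime_nat_iff two_is_prime_nat by blast
  with CHAR_dvd_CARD[where 'a = 'f] assms show False by simp
qed

text \<open>
  Squaring is two-to-one on the nonzero elements, because \<open>u \<noteq> - u\<close> for \<open>u \<noteq> 0\<close>.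
\<close>

lemma card_nonzero_squares:
  assumes "odd CARD('f :: {field,finite})"
  shows "CARD('f) = Suc (2 * card ((\<lambda>x :: 'f. x\<^sup>2) ` (- {0})))"
proof -
  let ?sq = "\<lambda>x :: 'f. x\<^sup>2"
  have fibre: "card {x \<in> - {0}. ?sq x = y} = 2" if "y \<in> ?sq ` (- {0})" for y
  proof -
    from that obtain u where u: "u \<noteq> 0" "y = u\<^sup>2" by auto
    have "{x \<in> - {0}. ?sq x = y} = {u, - u}" using u by (auto simp: power2_eq_iff)
    moreover have "u \<noteq> - u"
    proof
      assume "u = - u"
      then have "2 * u = 0" by (metis add.right_inverse mult_2)
      with u two_neq_0_if_odd_CARD[OF assms] show False by simp
    qed
    ultimately show ?thesis by simp
  qed
  have "card (- {0 :: 'f}) = (\<Sum>y \<in> ?sq ` (- {0}). card {x \<in> - {0}. ?sq x = y})"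
    using sum.image_gen[of "- {0}" "\<lambda>_. 1::nat" ?sq] by simp
  also have "\<dots> = 2 * card (?sq ` (- {0}))" using fibre by simp
  finally show ?thesis
    using zero_less_card_finite[where 'a = 'f]
    by (simp add: Compl_eq_Diff_UNIV card_Diff_singleton del: zero_less_card_finite)
qed

lemma nonsquare_exists:
  assumes "odd CARD('f :: {field,finite})"
  shows "\<exists>v :: 'f. \<forall>t. v \<noteq> t\<^sup>2"
proof (rule ccontr)
  assume "\<not> ?thesis"
  then have "- {0 :: 'f} \<subseteq> (\<lambda>x. x\<^sup>2) ` (- {0})"
    by (force simp: image_iff)
  then have "card (- {0 :: 'f}) \<le> card ((\<lambda>x :: 'f. x\<^sup>2) ` (- {0}))" by (intro card_mono) auto
  moreover have "(1 :: 'f) \<in> (\<lambda>x. x\<^sup>2) ` (- {0})" by (rule image_eqI[of _ _ 1]) auto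
  then have "card ((\<lambda>x :: 'f. x\<^sup>2) ` (- {0})) > 0" by (subst card_gt_0_iff) auto
  moreover have "card (- {0 :: 'f}) = CARD('f) - 1"
    by (simp add: Compl_eq_Diff_UNIV card_Diff_singleton)
  ultimately show False using card_nonzero_squares[OF assms] by linarith
qed

text \<open>
  If \<open>S\<close> is the set of nonzero squares and \<open>a\<close> is a nonsquare, then \<open>S\<close> and \<open>a S\<close> are disjoint and
  each contains half of the nonzero elements. Hence every nonsquare lies in \<open>a S\<close>.
\<close>

lemma quotient_of_nonsquares_is_square:
  assumes "odd CARD('f :: {field,finite})"
    and a: "\<And>t. (a :: 'f) \<noteq> t\<^sup>2" and b: "\<And>t. (b :: 'f) \<noteq> t\<^sup>2"
  shows "\<exists>t. b = a * t\<^sup>2"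
proof -
  let ?S = "(\<lambda>x :: 'f. x\<^sup>2) ` (- {0})"
  have a0: "a \<noteq> 0" and b0: "b \<noteq> 0" using a[of 0] b[of 0] by auto
  have disj: "?S \<inter> (*) a ` ?S = {}"
  proof (rule ccontr)
    assume "\<not> ?thesis"
    then obtain x y where "x\<^sup>2 = a * y\<^sup>2" "y \<noteq> 0" by auto
    then have "a = (x / y)\<^sup>2" by (simp add: power_divide)
    with a show False by blast
  qed
  have "card ((*) a ` ?S) = card ?S" using a0 by (intro card_image inj_onI) simp
  then have "card (?S \<union> (*) a ` ?S) = card (- {0 :: 'f})"
    using card_nonzero_squares[OF assms(1)] disj
    by (simp add: card_Un_disjoint Compl_eq_Diff_UNIV card_Diff_singleton)
  then have "?S \<union> (*) a ` ?S = - {0}" using a0 by (intro card_subset_eq) auto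
  then have "b \<in> ?S \<union> (*) a ` ?S" using b0 by blast
  then show ?thesis using b by auto
qed

text \<open>
  The values \<open>a x\<^sup>2\<close> and the values \<open>1 - b y\<^sup>2\<close> both fill more than half of the field, so the two
  sets of values meet.
\<close>

lemma binary_form_represents_1:
  assumes "odd CARD('f :: {field,finite})" and "(a :: 'f) \<noteq> 0" and "b \<noteq> 0"
  shows "\<exists>x y. a * x\<^sup>2 + b * y\<^sup>2 = 1"
proof -
  let ?Q = "range (\<lambda>x :: 'f. x\<^sup>2)"
  have "?Q = insert 0 ((\<lambda>x :: 'f. x\<^sup>2) ` (- {0}))"
    by auto
  also have "card \<dots> = Suc (card ((\<lambda>x :: 'f. x\<^sup>2) ` (- {0})))"
    by (rule card_insert_disjoint) auto
  finally have card_Q: "2 * card ?Q = Suc CARD('f)"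
    using card_nonzero_squares[OF assms(1)] by simp
  have 1: "card ((*) a ` ?Q) = card ?Q" using assms by (intro card_image inj_onI) simp
  have 2: "card ((\<lambda>s. 1 - b * s) ` ?Q) = card ?Q" using assms by (intro card_image inj_onI) simp
  have "(*) a ` ?Q \<inter> (\<lambda>s. 1 - b * s) ` ?Q \<noteq> {}"
  proof
    assume "(*) a ` ?Q \<inter> (\<lambda>s. 1 - b * s) ` ?Q = {}"
    then have "card ((*) a ` ?Q \<union> (\<lambda>s. 1 - b * s) ` ?Q) = 2 * card ?Q"
      using 1 2 by (simp add: card_Un_disjoint)
    also have "\<dots> > CARD('f)" using card_Q by simp
    finally show False by (metis card_mono finite not_le subset_UNIV)
  qed
  then obtain x y where "a * x\<^sup>2 = 1 - b * y\<^sup>2" by auto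
  then have "a * x\<^sup>2 + b * y\<^sup>2 = 1" by simp
  then show ?thesis by blast
qed

section \<open>Determinants of congruent diagonal matrices\<close>

lemma det_diagonal:
  "det (mat r r (\<lambda>(i, j). if i = j then a i else 0)) = (\<Prod>i<r. a i :: 'a :: idom)"
proof -
  let ?D = "mat r r (\<lambda>(i, j). if i = j then a i else 0)"
  have "det ?D = prod_list (diag_mat ?D)"
    by (rule det_upper_triangular[of _ r]) auto
  also have "diag_mat ?D = map a [0..<r]" by (auto simp: diag_mat_def)
  also have "prod_list \<dots> = (\<Prod>i<r. a i)"
    by (simp add: prod.list_conv_set_nth atLeast0LessThan)
  finally show ?thesis .
qed

text \<open>
  Take determinants in \<open>D\<^sub>a = P\<^sup>T D\<^sub>b P\<close>: the diagonal products differ by the square of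
  \<open>det P\<close>.
\<close>

lemma congruent_diagonal_prod:
  fixes a b :: "nat \<Rightarrow> 'a :: idom"
  assumes "\<And>i j. i < r \<Longrightarrow> j < r \<Longrightarrow> (\<Sum>k<r. P k i * b k * P k j) = (if i = j then a i else 0)"
  shows "\<exists>t. (\<Prod>i<r. a i) = t\<^sup>2 * (\<Prod>i<r. b i)"
proof -
  define M where "M = mat r r (\<lambda>(i, j). P i j)"
  define D where "D c = mat r r (\<lambda>(i, j). if i = j then c i else 0)" for c :: "nat \<Rightarrow> 'a"
  have carrier: "M \<in> carrier_mat r r" "D c \<in> carrier_mat r r" for c
    by (simp_all add: M_def D_def)
  have "D a = transpose_mat M * (D b * M)"
  proof (rule eq_matI)
    fix i j assume "i < dim_row (transpose_mat M * (D b * M))"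
      "j < dim_col (transpose_mat M * (D b * M))"
    then have ij: "i < r" "j < r" using carrier by auto
    have DM: "(D b * M) $$ (k, j) = b k * P k j" if "k < r" for k
      using that ij by (simp add: D_def M_def scalar_prod_def if_distrib if_distribR cong: if_cong)
    have "(transpose_mat M * (D b * M)) $$ (i, j) = (\<Sum>k<r. P k i * (D b * M) $$ (k, j))"
    proof -
      have "(transpose_mat M * (D b * M)) $$ (i, j) = row (transpose_mat M) i \<bullet> col (D b * M) j"
        using ij carrier by (intro index_mult_mat) auto
      also have "\<dots> = (\<Sum>k<r. row (transpose_mat M) i $ k * col (D b * M) j $ k)"
        using carrier(1) by (simp add: scalar_prod_def atLeast0LessThan D_def)
      also have "\<dots> = (\<Sum>k<r. P k i * (D b * M) $$ (k, j))"
      proof (intro sum.cong refl arg_cong2[where f = "(*)"])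
        fix k assume "k \<in> {..<r}"
        then show "row (transpose_mat M) i $ k = P k i" using ij by (simp add: M_def)
        show "col (D b * M) j $ k = (D b * M) $$ (k, j)"
          using \<open>k \<in> {..<r}\<close> ij by (intro index_col) (auto simp: D_def M_def)
      qed
      finally show ?thesis .
    qed
    also have "\<dots> = (\<Sum>k<r. P k i * b k * P k j)"
      by (intro sum.cong) (simp_all add: DM mult.assoc)
    finally show "D a $$ (i, j) = (transpose_mat M * (D b * M)) $$ (i, j)"
      using assms ij by (simp add: D_def)
  qed (use carrier in auto)
  moreover have "D b * M \<in> carrier_mat r r" using carrier by (intro mult_carrier_mat) auto
  ultimately have "det (D a) = det M * (det (D b) * det M)"
    using carrier by (simp add: det_mult[of _ r] det_transpose[of _ r])
  then show ?thesis
    unfolding D_def det_diagonal by (intro exI[of _ "det M"]) (simp add: power2_eq_square mult_ac)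
qed

section \<open>Diagonal frames of a product\<close>

text \<open>
  The vectors \<open>e 0, \<dots>, e (r - 1)\<close> are an orthogonal system for the form, the last vector \<open>e r\<close>
  spans the line of values, and \<open>a i\<close> is the value of the form at \<open>e i\<close>, measured in units of
  \<open>e r\<close>. Linear independence is left out of the definition because it follows, see
  \<open>diagonal_frame_coeffs_eq_0\<close>.
\<close>

definition diagonal_frame ::
    "('f::field \<Rightarrow> 'v::ab_group_add \<Rightarrow> 'v) \<Rightarrow> ('v \<Rightarrow> 'v \<Rightarrow> 'v) \<Rightarrow> nat \<Rightarrow> (nat \<Rightarrow> 'f) \<Rightarrow> (nat \<Rightarrow> 'v) \<Rightarrow> bool"
  where
  "diagonal_frame scale m r a e \<longleftrightarrow> e r \<noteq> 0 \<and> (\<forall>i<r. a i \<noteq> 0) \<and>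
     (\<forall>i\<le>r. \<forall>j\<le>r. m (e i) (e j) = (if i = j \<and> i < r then scale (a i) (e r) else 0))"

context vector_space
begin

lemma product_bilinear:
  assumes "algebra_product scale m"
  shows "m (x + y) w = m x w + m y w" "m x (y + w) = m x y + m x w"
    "m (c *s x) y = c *s m x y" "m x (c *s y) = c *s m x y"
    "m (sum g A) y = (\<Sum>i\<in>A. m (g i) y)" "m x (sum g A) = (\<Sum>i\<in>A. m x (g i))"
    "m 0 y = 0"
proof -
  interpret R: Vector_Spaces.linear scale scale "m x" for x
    using assms by (auto simp: algebra_product_def)
  interpret L: Vector_Spaces.linear scale scale "\<lambda>x. m x y" for y
    using assms by (auto simp: algebra_product_def)
  show "m (x + y) w = m x w + m y w" "m x (y + w) = m x y + m x w"
    "m (c *s x) y = c *s m x y" "m x (c *s y) = c *s m x y"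
    "m (sum g A) y = (\<Sum>i\<in>A. m (g i) y)" "m x (sum g A) = (\<Sum>i\<in>A. m x (g i))"
    "m 0 y = 0"
    by (rule L.add R.add L.scale R.scale L.sum R.sum L.zero)+
qed

lemma diagonal_frameD:
  fixes a :: "nat \<Rightarrow> 'a" and e :: "nat \<Rightarrow> 'b"
  assumes "diagonal_frame scale m r a e"
  shows "e r \<noteq> 0" "i < r \<Longrightarrow> a i \<noteq> 0"
    "i \<le> r \<Longrightarrow> j \<le> r \<Longrightarrow> m (e i) (e j) = (if i = j \<and> i < r then a i *s e r else 0)"
  using assms by (auto simp: diagonal_frame_def)

lemma product_diagonal_frame:
  assumes m: "algebra_product scale m" and e: "diagonal_frame scale m r a e"
  shows "m (\<Sum>i\<le>r. c i *s e i) (\<Sum>j\<le>r. c' j *s e j) = (\<Sum>i<r. c i * a i * c' i) *s e r"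
proof -
  have "m (\<Sum>i\<le>r. c i *s e i) (\<Sum>j\<le>r. c' j *s e j) = 
    (\<Sum>i\<le>r. \<Sum>j\<le>r. c i *s c' j *s m (e i) (e j))"
    by (subst product_bilinear(5)[OF m]) (simp add: product_bilinear(3,4,6)[OF m] scale_sum_right mult.commute)
  also have "\<dots> = (\<Sum>i\<le>r. \<Sum>j\<le>r. if j = i then (if i < r then (c i * a i * c' i) *s e r else 0) else 0)"
    by (intro sum.cong refl) (auto simp: diagonal_frameD(3)[OF e] mult_ac)
  also have "\<dots> = (\<Sum>i\<le>r. if i < r then (c i * a i * c' i) *s e r else 0)"
    by (intro sum.cong) simp_all
  also have "\<dots> = (\<Sum>i<r. (c i * a i * c' i) *s e r)"
    by (rule sum.mono_neutral_cong_right) auto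
  finally show ?thesis by (simp add: scale_sum_left)
qed

lemma sum_scale_frame_single:
  fixes r :: nat
  assumes "j \<le> r"
  shows "(\<Sum>i\<le>r. (if i = j then c else 0) *s e i) = c *s e j"
proof -
  have "(\<Sum>i\<le>r. (if i = j then c else 0) *s e i) = (\<Sum>i\<le>r. if i = j then c *s e i else 0)"
    by (intro sum.cong) auto
  also have "\<dots> = c *s e j" using assms by (subst sum.delta) auto
  finally show ?thesis .
qed

text \<open>
  Multiplying a linear relation by \<open>e j\<close> isolates the coefficient of \<open>e j\<close> for \<open>j < r\<close>; what remains
  is a multiple of \<open>e r \<noteq> 0\<close>.
\<close>

lemma diagonal_frame_coeffs_eq_0:
  assumes m: "algebra_product scale m" and e: "diagonal_frame scale m r a e"
    and 0: "(\<Sum>i\<le>r. c i *s e i) = 0" and "i \<le> r"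
  shows "c i = 0"
proof -
  have below: "c j = 0" if "j < r" for j
  proof -
    have "m (\<Sum>i\<le>r. c i *s e i) (\<Sum>i\<le>r. (if i = j then 1 else 0) *s e i)
        = (\<Sum>i<r. c i * a i * (if i = j then 1 else 0)) *s e r"
      by (rule product_diagonal_frame[OF m e])
    then have "(c j * a j) *s e r = 0"
      using that by (simp add: 0 product_bilinear[OF m] if_distrib cong: if_cong)
    with diagonal_frameD[OF e] that show ?thesis by simp
  qed
  then have "(\<Sum>i\<le>r. c i *s e i) = (\<Sum>i\<le>r. (if i = r then c r else 0) *s e i)"
    by (intro sum.cong) auto
  with 0 have "c r *s e r = 0" by (simp add: sum_scale_frame_single)
  with diagonal_frameD(1)[OF e] below \<open>i \<le> r\<close> show ?thesis by (cases "i = r") auto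
qed

lemma diagonal_frame_inj_independent:
  assumes m: "algebra_product scale m" and e: "diagonal_frame scale m r a e"
  shows "inj_on e {..r}" "independent (e ` {..r})"
proof -
  note coeffs = diagonal_frame_coeffs_eq_0[OF m e]
  show inj: "inj_on e {..r}"
  proof (rule inj_onI, rule ccontr)
    fix i j assume ij: "i \<in> {..r}" "j \<in> {..r}" "e i = e j" "i \<noteq> j"
    let ?c = "\<lambda>k. (if k = i then 1 else 0) - (if k = j then 1 else 0) :: 'a"
    have "(\<Sum>k\<le>r. ?c k *s e k) = 1 *s e i - 1 *s e j"
      using ij unfolding scale_left_diff_distrib sum_subtractf
      by (simp only: sum_scale_frame_single atMost_iff)
    with ij have "?c i = 0" using coeffs[of ?c i] by simp
    with ij show False by simp
  qed
  show "independent (e ` {..r})"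
  proof (rule independent_if_scalars_zero)
    fix f x assume "(\<Sum>x\<in>e ` {..r}. f x *s x) = 0" "x \<in> e ` {..r}"
    moreover have "(\<Sum>x\<in>e ` {..r}. f x *s x) = (\<Sum>i\<le>r. f (e i) *s e i)"
      using inj by (rule sum.reindex_cong) auto
    ultimately show "f x = 0" using coeffs[of "\<lambda>i. f (e i)"] by auto
  qed simp
qed

end

context finite_dimensional_vector_space
begin

lemma diagonal_frame_span:
  assumes "algebra_product scale m" "diagonal_frame scale m r a e" "dim UNIV = Suc r"
  shows "span (e ` {..r}) = UNIV"
proof -
  note ie = diagonal_frame_inj_independent[OF assms(1,2)]
  have "card (e ` {..r}) = dim UNIV" using ie(1) assms(3) by (simp add: card_image)
  with ie(2) show ?thesis using card_eq_dim[of "e ` {..r}" UNIV] by auto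
qed

lemma diagonal_frame_coordinates:
  assumes "algebra_product scale m" "diagonal_frame scale m r a e" "dim UNIV = Suc r"
  obtains c where "x = (\<Sum>i\<le>r. c i *s e i)"
proof -
  have "x \<in> span (e ` {..r})" using diagonal_frame_span[OF assms] by simp
  then obtain u where "(\<Sum>v\<in>e ` {..r}. u v *s v) = x" by (auto simp: span_finite)
  moreover have "(\<Sum>v\<in>e ` {..r}. u v *s v) = (\<Sum>i\<le>r. u (e i) *s e i)"
    using diagonal_frame_inj_independent(1)[OF assms(1,2)] by (rule sum.reindex_cong) auto
  ultimately show ?thesis using that by metis
qed

text \<open>
  The linear map sending one frame to the other respects the multiplication table of the frame,
  hence all products.
\<close>

lemma diagonal_frames_isomorphic:
  assumes m: "algebra_product scale m" "diagonal_frame scale m r a e"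
    and m': "algebra_product scale m'" "diagonal_frame scale m' r a e'"
    and dim: "dim UNIV = Suc r"
  shows "algebra_isomorphic scale m m'"
proof -
  interpret pair: vector_space_pair scale scale by unfold_locales
  note ie = diagonal_frame_inj_independent[OF m]
  obtain f where f: "Vector_Spaces.linear scale scale f"
    and f_e: "\<forall>x \<in> e ` {..r}. f x = e' (the_inv_into {..r} e x)"
    using pair.linear_independent_extend[OF ie(2), of "\<lambda>x. e' (the_inv_into {..r} e x)"]
    by blast
  have f_e: "f (e i) = e' i" if "i \<le> r" for i
    using f_e that ie(1) by (simp add: the_inv_into_f_f)
  interpret f: Vector_Spaces.linear scale scale f by (fact f)
  have f_sum: "f (\<Sum>i\<le>r. c i *s e i) = (\<Sum>i\<le>r. c i *s e' i)" for c
    by (simp add: f.sum f.scale f_e)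
  have surj: "surj f"
  proof (rule surjI)
    fix y
    obtain c where "y = (\<Sum>i\<le>r. c i *s e' i)"
      using diagonal_frame_coordinates[OF m' dim] by blast
    then have "\<exists>x. f x = y" using f_sum by metis
    then show "f (SOME x. f x = y) = y" by (rule someI_ex)
  qed
  have "f (m x y) = m' (f x) (f y)" for x y
  proof -
    obtain c where c: "x = (\<Sum>i\<le>r. c i *s e i)"
      using diagonal_frame_coordinates[OF m dim] by blast
    obtain c' where c': "y = (\<Sum>i\<le>r. c' i *s e i)"
      using diagonal_frame_coordinates[OF m dim] by blast
    show ?thesis
      unfolding c c' f_sum product_diagonal_frame[OF m] product_diagonal_frame[OF m']
      by (simp add: f.scale f_e)
  qed
  moreover have "bij f" using surj linear_surj_imp_inj[OF f] by (simp add: bij_def)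
  ultimately show ?thesis using f unfolding algebra_isomorphic_def by blast
qed

text \<open>
  If a homomorphism \<open>f\<close> maps the last vector to \<open>c\<close> times the last vector, then the second form pulls
  back along \<open>f\<close> to \<open>c\<close> times the first. The components along \<open>e' r\<close> annihilate everything, so the
  remaining \<open>r \<times> r\<close> coefficients of \<open>f\<close> realise a congruence of diagonal matrices; the scalar \<open>c\<close>
  enters the determinant \<open>r\<close> times. The lemma is applied both to isomorphisms of two products and,
  with \<open>f\<close> the identity, to two frames of a single product.
\<close>

lemma diagonal_frames_discriminant:
  assumes m: "algebra_product scale m" "diagonal_frame scale m r a e"
    and m': "algebra_product scale m'" "diagonal_frame scale m' r a' e'"
    and dim: "dim UNIV = Suc r"
    and f: "Vector_Spaces.linear scale scale f" "\<And>x y. f (m x y) = m' (f x) (f y)"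
    and c: "f (e r) = c *s e' r"
  shows "\<exists>t. c ^ r * (\<Prod>i<r. a i) = t\<^sup>2 * (\<Prod>i<r. a' i)"
proof -
  interpret f: Vector_Spaces.linear scale scale f by (fact f)
  have "\<forall>j. \<exists>q. f (e j) = (\<Sum>k\<le>r. q k *s e' k)"
    using diagonal_frame_coordinates[OF m' dim] by metis
  then obtain P where P: "\<And>j. f (e j) = (\<Sum>k\<le>r. P j k *s e' k)" by metis
  have "(\<Sum>k<r. P i k * a' k * P j k) = (if i = j then c * a i else 0)" if "i < r" "j < r" for i j
  proof -
    have "(\<Sum>k<r. P i k * a' k * P j k) *s e' r = f (m (e i) (e j))"
      using product_diagonal_frame[OF m'] by (simp add: f(2) P)
    also have "\<dots> = (if i = j then c * a i else 0) *s e' r"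
      using that by (simp add: diagonal_frameD(3)[OF m(2)] f.scale f.zero c mult.commute)
    finally show ?thesis using diagonal_frameD(1)[OF m'(2)] by (simp only: scale_cancel_right) simp
  qed
  from congruent_diagonal_prod[OF this] show ?thesis by (simp add: prod.distrib)
qed

text \<open>
  In the source, \<open>e r\<close> is a multiple of the product \<open>e 0 \<cdot> e 0\<close>; in the target, every product is a
  multiple of \<open>e' r\<close>.
\<close>

lemma hom_last_vector_multiple:
  assumes m': "algebra_product scale m'" "diagonal_frame scale m' r a' e'"
    and m: "diagonal_frame scale m r a e" and "r > 0"
    and dim: "dim UNIV = Suc r"
    and f: "Vector_Spaces.linear scale scale f" "\<And>x y. f (m x y) = m' (f x) (f y)"
  shows "\<exists>c. f (e r) = c *s e' r"
proof -
  interpret f: Vector_Spaces.linear scale scale f by (fact f)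
  obtain p where p: "f (e 0) = (\<Sum>k\<le>r. p k *s e' k)"
    using diagonal_frame_coordinates[OF m' dim] by blast
  have "f (m (e 0) (e 0)) = a 0 *s f (e r)"
    using \<open>r > 0\<close> by (simp add: diagonal_frameD[OF m] f.scale)
  moreover have "f (m (e 0) (e 0)) = (\<Sum>i<r. p i * a' i * p i) *s e' r"
    unfolding f(2) p by (rule product_diagonal_frame[OF m'])
  ultimately have "f (e r) = (inverse (a 0) * (\<Sum>i<r. p i * a' i * p i)) *s e' r"
    using diagonal_frameD(2)[OF m \<open>r > 0\<close>] by (metis left_inverse scale_one scale_scale)
  then show ?thesis by blast
qed

end

context finite_dimensional_vector_space
begin

text \<open>
  In coordinates with respect to a basis, the product is
  \<open>x \<cdot> y = (\<Sum>i<r. a i * x\<^sub>i * y\<^sub>i) e\<^sub>r\<close>. All iterated products vanish since \<open>e\<^sub>r\<close> has the coordinates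
  \<open>0\<close> below \<open>r\<close>.
\<close>

lemma diagonal_product_exists:
  assumes dim: "dim UNIV = Suc r" and "r > 0" and a: "\<And>i. i < r \<Longrightarrow> a i \<noteq> 0"
  shows "\<exists>m e. m \<in> admissible_products scale \<and> diagonal_frame scale m r a e"
proof -
  have "card Basis = Suc r"
    using dim by (simp add: dimension_def)
  then obtain e where e: "bij_betw e {..r} Basis"
    using ex_bij_betw_nat_finite[OF finite_Basis] by (auto simp: atLeast0LessThan lessThan_Suc_atMost)
  define coord where "coord i x = representation Basis x (e i)" for i x
  have coord_simps: "coord i (x + y) = coord i x + coord i y" "coord i (c *s x) = c * coord i x" for i x y c
    by (simp_all add: coord_def representation_add representation_scale independent_Basis span_Basis)
  have e_Basis: "e i \<in> Basis" if "i \<le> r" for i using e that by (auto simp: bij_betw_def)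
  have coord_e: "coord i (e j) = (if i = j then 1 else 0)" if "i \<le> r" "j \<le> r" for i j
  proof -
    have "e i = e j \<longleftrightarrow> i = j" using e that by (auto simp: bij_betw_def inj_on_def)
    then show ?thesis
      using e_Basis[OF that(2)] by (simp add: coord_def representation_basis independent_Basis)
  qed
  have expand: "x = (\<Sum>i\<le>r. coord i x *s e i)" for x
  proof -
    have "x = (\<Sum>b\<in>Basis. representation Basis x b *s b)"
      by (simp add: sum_representation_eq independent_Basis span_Basis finite_Basis)
    also have "\<dots> = (\<Sum>i\<le>r. coord i x *s e i)"
      unfolding coord_def by (rule sum.reindex_bij_betw[OF e, symmetric])
    finally show ?thesis .
  qed
  define m where "m x y = (\<Sum>i<r. a i * coord i x * coord i y) *s e r" for x y
  have e_r: "e r \<noteq> 0" using e_Basis independent_Basis dependent_zero by force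
  have m_e: "m x (e j) = (if j < r then (a j * coord j x) *s e r else 0)" if "j \<le> r" for x j
  proof -
    have "(\<Sum>i<r. a i * coord i x * coord i (e j)) = (\<Sum>i<r. if i = j then a i * coord i x else 0)"
      using that by (intro sum.cong) (auto simp: coord_e)
    then show ?thesis by (simp add: m_def)
  qed
  have frame: "diagonal_frame scale m r a e"
    unfolding diagonal_frame_def using e_r a by (auto simp: m_e coord_e)
  have linear: "Vector_Spaces.linear scale scale (m x)" "Vector_Spaces.linear scale scale (\<lambda>x. m x y)" for x y
    by (unfold_locales; simp add: m_def coord_simps algebra_simps sum.distrib sum_distrib_left scale_left_distrib)+
  have zero: "m (m x y) w = 0" "m w (m x y) = 0" for x y w
    by (simp_all add: m_def coord_simps coord_e)
  have algebra: "algebra_product scale m"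
    using linear zero by (simp add: algebra_product_def)
  have square: "square_space scale m = span {e r}"
  proof -
    have "m x y \<in> span {e r}" for x y by (simp add: m_def span_base span_scale)
    then have "square_space scale m \<subseteq> span {e r}"
      unfolding square_space_def by (intro span_minimal) (auto simp: subspace_span)
    moreover have "m (inverse (a 0) *s e 0) (e 0) = e r"
      using \<open>r > 0\<close> a[of 0] diagonal_frameD(3)[OF frame, of 0 0] by (simp add: product_bilinear[OF algebra])
    then have "e r \<in> {m x y |x y. True}" by (metis (mono_tags, lifting) mem_Collect_eq)
    then have "span {e r} \<subseteq> square_space scale m"
      unfolding square_space_def by (intro span_mono) simp
    ultimately show ?thesis by blast
  qed
  have "annihilator m = span {e r}"
  proof (intro equalityI subsetI)
    fix x assume "x \<in> annihilator m"
    then have "m x (e i) = 0" for i by (simp add: annihilator_def)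
    then have "coord i x = 0" if "i < r" for i
      using that e_r a[OF that] m_e[of i x] by simp
    then have "x = (\<Sum>i\<le>r. (if i = r then coord r x else 0) *s e i)"
      by (subst expand) (auto intro!: sum.cong)
    then have "x = coord r x *s e r" by (simp add: sum_scale_frame_single)
    then show "x \<in> span {e r}" by (metis insertI1 span_base span_scale)
  next
    fix x assume "x \<in> span {e r}"
    then obtain c where "x = c *s e r" by (auto simp: span_singleton)
    then show "x \<in> annihilator m" by (simp add: annihilator_def m_def coord_simps coord_e)
  qed
  moreover have "dim (span {e r}) = 1"
    using e_r by (simp add: dim_eq_card_independent)
  ultimately have "m \<in> admissible_products scale"
    using algebra square zero
    by (simp add: admissible_products_def commutative_product_def three_nilpotent_def)
       (simp add: m_def mult_ac)
  with frame show ?thesis by blast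
qed

lemma admissible_square_space_nontrivial:
  assumes "m \<in> admissible_products scale"
  obtains z where "z \<noteq> 0" "z \<in> square_space scale m"
proof -
  have "\<not> square_space scale m \<subseteq> span {}"
  proof
    assume "square_space scale m \<subseteq> span {}"
    then have "dim (square_space scale m) \<le> card ({} :: 'b set)" by (rule dim_le_card) simp
    with assms show False by (simp add: admissible_products_def)
  qed
  then show ?thesis using that by auto
qed

lemma admissible_square_space_line:
  assumes "m \<in> admissible_products scale" "z \<in> square_space scale m" "z \<noteq> 0"
  shows "square_space scale m = span {z}"
proof
  show "square_space scale m \<subseteq> span {z}"
    using assms card_eq_dim[of "{z}" "square_space scale m"]
    by (simp add: admissible_products_def)
  show "span {z} \<subseteq> square_space scale m"
    using assms(2) unfolding square_space_def by (intro span_minimal) (auto simp: subspace_span)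
qed

end

section \<open>Orthogonal systems for a form whose radical is a line\<close>

text \<open>
  After the choice of a vector \<open>z\<close> spanning \<open>V \<cdot> V\<close>, a product \<open>x \<cdot> y = B x y z\<close> is the same thing as a
  symmetric bilinear form \<open>B\<close>, and the condition on the annihilator says that the radical of \<open>B\<close> is the
  line through \<open>z\<close>.
\<close>

locale line_radical_form = finite_dimensional_vector_space scale Basis
  for scale :: "'f::field \<Rightarrow> 'v::ab_group_add \<Rightarrow> 'v" (infixr "*s" 75) and Basis +
  fixes B :: "'v \<Rightarrow> 'v \<Rightarrow> 'f" and z :: 'v
  assumes B_add: "B (x + y) w = B x w + B y w"
    and B_scale: "B (c *s x) w = c * B x w"
    and B_sym: "B x y = B y x"
    and radical: "(\<And>y. B x y = 0) \<Longrightarrow> x \<in> span {z}"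
    and char_neq_2: "(2 :: 'f) \<noteq> 0"
begin

lemma B_right: "B w (x + y) = B w x + B w y" "B w (c *s x) = c * B w x"
  using B_add B_scale B_sym by metis+

lemma B_sum_right: "B w (\<Sum>i\<in>A. g i) = (\<Sum>i\<in>A. B w (g i))"
proof -
  have "B w 0 = 0" using B_right(2)[of w 0 0] by simp
  then show ?thesis by (induction A rule: infinite_finite_induct) (simp_all add: B_right)
qed

text \<open>
  Otherwise the form vanishes, by polarization, on the orthogonal complement \<open>U\<close> of the given vectors.
  These are anisotropic, so their span and \<open>U\<close> add up to the whole space, and \<open>U\<close> is orthogonal to
  both summands. Hence \<open>U\<close> lies in the radical, and the \<open>s\<close> vectors together with \<open>z\<close> span the whole
  space, whose dimension exceeds \<open>s + 1\<close>.
\<close>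

lemma orthogonal_extension:
  assumes e: "\<And>i j. i < s \<Longrightarrow> j < s \<Longrightarrow> B (e i) (e j) = 0 \<longleftrightarrow> i \<noteq> j"
    and dim: "Suc s < dim UNIV"
  obtains u where "\<And>i. i < s \<Longrightarrow> B u (e i) = 0" "B u u \<noteq> 0"
proof (rule ccontr)
  assume no_u: "\<not> thesis"
  \<comment> \<open>orthogonal projection onto the span of \<open>e 0, \<dots>, e (s - 1)\<close>\<close>
  define proj where "proj x = (\<Sum>i<s. (B x (e i) / B (e i) (e i)) *s e i)" for x
  have B_proj: "B (e j) (x - proj x) = 0" if "j < s" for x j
  proof -
    have "B (e j) (proj x) = (\<Sum>i<s. if i = j then B x (e j) else 0)"
      unfolding proj_def B_sum_right B_right using e that by (intro sum.cong) auto
    then have "B (e j) (proj x) = B (e j) x" using that B_sym by simp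
    then show ?thesis using B_right(1)[of "e j" "x - proj x" "proj x"] by simp
  qed
  have B_proj_right: "B w (proj x) = (\<Sum>i<s. B x (e i) / B (e i) (e i) * B w (e i))" for w x
    by (simp only: proj_def B_sum_right B_right)
  have null: "B u u = 0" if "\<And>i. i < s \<Longrightarrow> B u (e i) = 0" for u
    using no_u \<open>\<And>u. (\<And>i. i < s \<Longrightarrow> B u (e i) = 0) \<Longrightarrow> B u u \<noteq> 0 \<Longrightarrow> thesis\<close> that by blast
  have null2: "B u w = 0" if u: "\<And>i. i < s \<Longrightarrow> B u (e i) = 0" and w: "\<And>i. i < s \<Longrightarrow> B w (e i) = 0" for u w
  proof -
    have "B (u + w) (u + w) = 0" using u w by (intro null) (simp add: B_add)
    then have "2 * B u w = 0"
      using null[OF u] null[OF w] by (simp add: B_add B_right B_sym[of w u])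
    then show ?thesis using char_neq_2 by simp
  qed
  have "x \<in> span (insert z (e ` {..<s}))" for x
  proof -
    let ?u = "x - proj x"
    have u: "B ?u (e i) = 0" if "i < s" for i using B_proj[OF that] B_sym by simp
    have "B ?u y = 0" for y
    proof -
      have "B ?u (y - proj y) = 0" by (rule null2) (use u B_proj B_sym in simp_all)
      moreover have "B ?u (proj y) = 0"
        unfolding B_proj_right using u by (intro sum.neutral) simp
      ultimately show ?thesis using B_right(1)[of ?u "y - proj y" "proj y"] by simp
    qed
    then have "?u \<in> span (insert z (e ` {..<s}))"
      using radical span_mono[of "{z}" "insert z (e ` {..<s})"] by blast
    moreover have "proj x \<in> span (insert z (e ` {..<s}))"
      unfolding proj_def by (intro span_sum span_scale span_base) auto
    ultimately show ?thesis using span_add by fastforce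
  qed
  then have "dim UNIV \<le> card (insert z (e ` {..<s}))" by (intro dim_le_card) auto
  also have "\<dots> \<le> Suc (card (e ` {..<s}))" by (simp add: card_insert_if)
  also have "\<dots> \<le> Suc s" using card_image_le[of "{..<s}" e] by simp
  finally show False using dim by simp
qed

text \<open>
  To add one unit vector, extend the system by two orthogonal anisotropic vectors and let a
  combination of the two represent \<open>1\<close>. The second extension is why two dimensions are kept in
  reserve: one is the radical, the other is the last diagonal entry, which cannot be normalised
  this way.
\<close>

lemma orthonormal_system_exists:
  assumes universal: "\<And>a b :: 'f. a \<noteq> 0 \<Longrightarrow> b \<noteq> 0 \<Longrightarrow> \<exists>x y. a * x\<^sup>2 + b * y\<^sup>2 = 1"
    and "s + 2 \<le> dim UNIV"
  shows "\<exists>e. \<forall>i<s. \<forall>j<s. B (e i) (e j) = (if i = j then 1 else 0)"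
  using \<open>s + 2 \<le> dim UNIV\<close>
proof (induction s)
  case (Suc s)
  then obtain e where e: "\<And>i j. i < s \<Longrightarrow> j < s \<Longrightarrow> B (e i) (e j) = (if i = j then 1 else 0)"
    by auto
  obtain u where u: "\<And>i. i < s \<Longrightarrow> B u (e i) = 0" "B u u \<noteq> 0"
    by (rule orthogonal_extension[of s e]) (use e Suc.prems in auto)
  define e' where "e' = e(s := u)"
  have "B (e' i) (e' j) = 0 \<longleftrightarrow> i \<noteq> j" if "i < Suc s" "j < Suc s" for i j
    using that e u B_sym[of "e i" u] by (auto simp: e'_def less_Suc_eq)
  then obtain w where w: "\<And>i. i < Suc s \<Longrightarrow> B w (e' i) = 0" "B w w \<noteq> 0"
    by (rule orthogonal_extension[of "Suc s" e']) (use Suc.prems in auto)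
  have w': "B w u = 0" "\<And>i. i < s \<Longrightarrow> B w (e i) = 0"
    using w(1)[of s] w(1)[of i for i] unfolding e'_def by (simp, metis fun_upd_other less_SucI nat_neq_iff)
  obtain x y where xy: "B u u * x\<^sup>2 + B w w * y\<^sup>2 = 1"
    using universal u(2) w(2) by blast
  define v where "v = x *s u + y *s w"
  have "B v v = 1"
    using xy w'(1) by (simp add: v_def B_add B_right B_scale B_sym[of u w] power2_eq_square mult_ac)
  moreover have "B v (e i) = 0" "B (e i) v = 0" if "i < s" for i
    using u w' that B_sym[of "e i" v] by (simp_all add: v_def B_add B_scale)
  ultimately have "\<forall>i<Suc s. \<forall>j<Suc s. B ((e(s := v)) i) ((e(s := v)) j) = (if i = j then 1 else 0)"
    using e by (auto simp: less_Suc_eq)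
  then show ?case by blast
qed simp

end

section \<open>Normal forms over a finite field of odd order\<close>

text \<open>
  The dimension is \<open>s + 2\<close>, the forms have rank \<open>s + 1\<close>; in a normal frame the vectors \<open>e 0, \<dots>, e (s - 1)\<close>
  are orthonormal, \<open>e s\<close> carries the discriminant, and \<open>e (Suc s)\<close> spans \<open>V \<cdot> V\<close>.
\<close>

locale odd_finite_space = finite_dimensional_vector_space scale Basis
  for scale :: "'f::{field,finite} \<Rightarrow> 'v::ab_group_add \<Rightarrow> 'v" (infixr "*s" 75) and Basis +
  fixes s :: nat
  assumes dim_UNIV_eq: "dim UNIV = Suc (Suc s)"
    and odd_CARD: "odd CARD('f)"
begin

definition weights :: "'f \<Rightarrow> nat \<Rightarrow> 'f" where
  "weights d = (\<lambda>_. 1)(s := d)"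

lemma prod_weights: "(\<Prod>i<Suc s. weights d i) = d"
  by (simp add: weights_def)

text \<open>
  The vector \<open>z\<close> can be prescribed: the freedom to rescale it is what removes the discriminant in
  odd rank.
\<close>

lemma normal_frame_exists:
  assumes m: "m \<in> admissible_products scale" and z: "z \<noteq> 0" "z \<in> square_space scale m"
  shows "\<exists>d e. d \<noteq> 0 \<and> e (Suc s) = z \<and> diagonal_frame scale m (Suc s) (weights d) e"
proof -
  have line: "square_space scale m = span {z}"
    by (rule admissible_square_space_line[OF m z(2,1)])
  from m have algebra: "algebra_product scale m" and comm: "m x y = m y x"
    and ann: "annihilator m = span {z}" for x y
    using line by (auto simp: admissible_products_def commutative_product_def)
  have "m x y \<in> span {z}" for x y
    unfolding line[symmetric] square_space_def by (rule span_base) auto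
  then have "\<forall>x y. \<exists>c. m x y = c *s z" by (auto simp: span_singleton)
  then obtain B where B: "m x y = B x y *s z" for x y by metis
  have B_eqI: "B x y = c" if "m x y = c *s z" for x y c
    using that z by (simp add: B)
  interpret form: line_radical_form scale Basis B z
  proof
    show "B (x + y) w = B x w + B y w" for x y w
      by (rule B_eqI) (simp only: product_bilinear[OF algebra] scale_left_distrib flip: B)
    show "B (c *s x) w = c * B x w" for c x w
      by (rule B_eqI) (simp only: product_bilinear[OF algebra] flip: B scale_scale)
    show "B x y = B y x" for x y
      by (rule B_eqI) (unfold B[symmetric], rule comm)
    show "x \<in> span {z}" if "\<And>y. B x y = 0" for x
      using that unfolding ann[symmetric] by (simp add: annihilator_def B)
    show "(2 :: 'f) \<noteq> 0" by (rule two_neq_0_if_odd_CARD[OF odd_CARD])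
  qed
  have "\<exists>e. \<forall>i<s. \<forall>j<s. B (e i) (e j) = (if i = j then 1 else 0)"
  proof (rule form.orthonormal_system_exists)
    show "s + 2 \<le> dim UNIV" by (simp only: dim_UNIV_eq add_2_eq_Suc' order_refl)
  qed (rule binary_form_represents_1[OF odd_CARD])
  then obtain e where e: "\<And>i j. i < s \<Longrightarrow> j < s \<Longrightarrow> B (e i) (e j) = (if i = j then 1 else 0)"
    by blast
  obtain u where u: "\<And>i. i < s \<Longrightarrow> B u (e i) = 0" "B u u \<noteq> 0"
    by (rule form.orthogonal_extension[of s e]) (use e dim_UNIV_eq in auto)
  have z0: "m z x = 0" "m x z = 0" for x
  proof -
    show "m z x = 0" using span_base[of z "{z}"] ann by (auto simp: annihilator_def)
    then show "m x z = 0" by (simp add: comm[of x])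
  qed
  have u': "B (e i) u = 0" if "i < s" for i using u(1)[OF that] form.B_sym by simp
  have "diagonal_frame scale m (Suc s) (weights (B u u)) (e(s := u, Suc s := z))"
    unfolding diagonal_frame_def weights_def
    using z u u' z0 e by (auto simp: B le_Suc_eq less_Suc_eq)
  then show ?thesis using u(2) by (intro exI[of _ "B u u"] exI[of _ "e(s := u, Suc s := z)"]) simp
qed

lemma rescale_normal_frame:
  assumes m: "algebra_product scale m" "diagonal_frame scale m (Suc s) (weights d) e" and "t \<noteq> 0"
  shows "diagonal_frame scale m (Suc s) (weights (d * t\<^sup>2)) (e(s := t *s e s))"
  using diagonal_frameD[OF m(2)] diagonal_frameD(2)[OF m(2), of s] \<open>t \<noteq> 0\<close>
  unfolding diagonal_frame_def weights_def
  by (auto simp: product_bilinear[OF m(1)] power2_eq_square mult_ac)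

text \<open>
  If the form has discriminant \<open>d\<close> in units of \<open>z\<close>, then in units of
  \<open>d z\<close> its discriminant is \<open>d / d ^ (s + 1)\<close> up to squares, which is the square of
  \<open>(1 / d) ^ (s div 2)\<close>.
\<close>

lemma normal_frame_1_if_odd_rank:
  assumes "even s" and m: "m \<in> admissible_products scale"
  shows "\<exists>e. diagonal_frame scale m (Suc s) (weights 1) e"
proof -
  have algebra: "algebra_product scale m" using m by (simp add: admissible_products_def)
  obtain z where z: "z \<noteq> 0" "z \<in> square_space scale m"
    using admissible_square_space_nontrivial[OF m] .
  obtain d e where d: "d \<noteq> 0" "e (Suc s) = z" and e: "diagonal_frame scale m (Suc s) (weights d) e"
    using normal_frame_exists[OF m z] by blast
  have "d *s z \<in> square_space scale m" using z(2) by (simp add: square_space_def span_scale)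
  then obtain d' e' where d': "d' \<noteq> 0" "e' (Suc s) = d *s z"
    and e': "diagonal_frame scale m (Suc s) (weights d') e'"
    using normal_frame_exists[OF m, of "d *s z"] d z by auto
  have "\<exists>t. inverse d ^ Suc s * (\<Prod>i<Suc s. weights d i) = t\<^sup>2 * (\<Prod>i<Suc s. weights d' i)"
    by (rule diagonal_frames_discriminant[OF algebra e algebra e' dim_UNIV_eq linear_id])
       (use d d' in simp_all)
  then obtain t where "inverse d ^ s = t\<^sup>2 * d'"
    unfolding prod_weights using d by (auto simp: field_simps)
  moreover from \<open>even s\<close> obtain h where "s = 2 * h" by blast
  ultimately have *: "(inverse d ^ h)\<^sup>2 = t\<^sup>2 * d'" by (simp add: power_mult power_mult_distrib mult.commute)
  \<comment> \<open>rescaling by \<open>w\<close> turns the discriminant \<open>d'\<close> into \<open>1\<close>\<close>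
  define w where "w = t / inverse d ^ h"
  have "t \<noteq> 0" using * d by auto
  with d d' * have "d' * w\<^sup>2 = 1" "w \<noteq> 0"
    by (auto simp: w_def power_divide field_simps)
  with rescale_normal_frame[OF algebra e', of w] show ?thesis by auto
qed

lemma normal_frame_1_or_nonsquare:
  assumes m: "m \<in> admissible_products scale" and v: "\<And>t. v \<noteq> t\<^sup>2"
  shows "\<exists>e. diagonal_frame scale m (Suc s) (weights 1) e \<or> diagonal_frame scale m (Suc s) (weights v) e"
proof -
  have algebra: "algebra_product scale m" using m by (simp add: admissible_products_def)
  obtain z where z: "z \<noteq> 0" "z \<in> square_space scale m"
    using admissible_square_space_nontrivial[OF m] .
  obtain d e where d: "d \<noteq> 0" and e: "diagonal_frame scale m (Suc s) (weights d) e"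
    using normal_frame_exists[OF m z] by blast
  show ?thesis
  proof (cases "\<exists>t. d = t\<^sup>2")
    case True
    then obtain t where t: "d = t\<^sup>2" by blast
    with d have "t \<noteq> 0" "d * (inverse t)\<^sup>2 = 1" by (auto simp: power2_eq_square field_simps)
    with rescale_normal_frame[OF algebra e, of "inverse t"] show ?thesis by auto
  next
    case False
    then obtain t where t: "v = d * t\<^sup>2"
      using quotient_of_nonsquares_is_square[OF odd_CARD, of d v] v by blast
    with v[of 0] have "t \<noteq> 0" by auto
    with rescale_normal_frame[OF algebra e, of t] t show ?thesis by auto
  qed
qed

text \<open>
  The rank \<open>s + 1\<close> is even, so the factor \<open>c ^ (s + 1)\<close> by which an isomorphism changes the
  discriminant is a square.
\<close>

lemma not_isomorphic_if_even_rank: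
  assumes "odd s" and v: "\<And>t. v \<noteq> t\<^sup>2"
    and m: "algebra_product scale m" "diagonal_frame scale m (Suc s) (weights 1) e"
    and m': "algebra_product scale m'" "diagonal_frame scale m' (Suc s) (weights v) e'"
  shows "\<not> algebra_isomorphic scale m m'"
proof
  assume "algebra_isomorphic scale m m'"
  then obtain f where f: "Vector_Spaces.linear scale scale f" "\<And>x y. f (m x y) = m' (f x) (f y)"
    and "bij f" unfolding algebra_isomorphic_def by blast
  interpret f: Vector_Spaces.linear scale scale f by (fact f)
  obtain c where c: "f (e (Suc s)) = c *s e' (Suc s)"
    using hom_last_vector_multiple[where f = f and m = m and m' = m', OF m' m(2) _ dim_UNIV_eq f(1)]
      f(2) by auto
  have "f (e (Suc s)) \<noteq> f 0"
    using diagonal_frameD(1)[OF m(2)] \<open>bij f\<close> by (metis bij_pointE)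
  with c have "c \<noteq> 0" by (auto simp: f.zero)
  obtain t where t: "c ^ Suc s = t\<^sup>2 * v"
    using diagonal_frames_discriminant[where f = f and m = m and m' = m',
        OF m m' dim_UNIV_eq f(1) _ c] f(2)
    unfolding prod_weights by auto
  from \<open>odd s\<close> obtain h where "Suc s = 2 * h" by (metis dvdE even_Suc)
  then have "c ^ Suc s = (c ^ h)\<^sup>2" by (metis mult.commute power_mult)
  with t have *: "(c ^ h)\<^sup>2 = t\<^sup>2 * v" by simp
  with \<open>c \<noteq> 0\<close> have "t \<noteq> 0" by auto
  with * have "v = (c ^ h / t)\<^sup>2" by (simp add: power_divide field_simps)
  with v show False by blast
qed

end

section \<open>Counting the isomorphism classes\<close>

lemma card_quotient_representatives:
  assumes R: "equiv A R" and X: "X \<subseteq> A"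
    and complete: "\<And>a. a \<in> A \<Longrightarrow> \<exists>x\<in>X. (x, a) \<in> R"
    and distinct: "\<And>x y. x \<in> X \<Longrightarrow> y \<in> X \<Longrightarrow> (x, y) \<in> R \<Longrightarrow> x = y"
  shows "card (A // R) = card X"
proof -
  have "A // R = (\<lambda>x. R `` {x}) ` X"
  proof (intro equalityI subsetI)
    fix C assume "C \<in> A // R"
    then obtain a where "a \<in> A" "C = R `` {a}" by (auto elim: quotientE)
    with complete equiv_class_eq[OF R] show "C \<in> (\<lambda>x. R `` {x}) ` X" by blast
  qed (use X in \<open>auto intro: quotientI\<close>)
  moreover have "inj_on (\<lambda>x. R `` {x}) X"
    using X distinct by (intro inj_onI) (metis R eq_equiv_class subsetD)
  ultimately show ?thesis by (simp add: card_image)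
qed

theorem theorem4p11:
  fixes p k n :: nat
    and scale :: "'f::{field,finite} \<Rightarrow> 'v::ab_group_add \<Rightarrow> 'v"
  assumes "prime p" and "odd p" and "k \<ge> 1" and "n \<ge> 2"
    and "CARD('f) = p ^ k"
    and "vector_space scale"
    and "vector_space.dim scale (UNIV :: 'v set) = n"
  shows "(even (n - 1) \<longrightarrow>
           card (admissible_products scale // iso_rel scale) = 2) \<and>
         (odd (n - 1) \<longrightarrow>
           card (admissible_products scale // iso_rel scale) = 1)"
proof -
  interpret vector_space scale by fact
  obtain s where n: "n = Suc (Suc s)"
    using \<open>n \<ge> 2\<close> by (metis One_nat_def Suc_le_D Suc_le_mono numeral_2_eq_2)
  obtain Basis where Basis: "independent Basis" "UNIV \<subseteq> span Basis" "card Basis = dim UNIV"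
    by (rule basis_exists[of UNIV]) auto
  interpret odd_finite_space scale Basis s
  proof
    show "finite Basis" using Basis(3) assms(7) n by (intro card_ge_0_finite) simp
  qed (use Basis assms n in auto)
  let ?A = "admissible_products scale" and ?R = "iso_rel scale"
  have R: "equiv ?A ?R" by (rule equiv_iso_rel) fact
  have algebra: "algebra_product scale m" if "m \<in> ?A" for m
    using that by (simp add: admissible_products_def)
  have iso: "(m, m') \<in> ?R" if "m \<in> ?A" "m' \<in> ?A"
    "diagonal_frame scale m (Suc s) (weights d) e" "diagonal_frame scale m' (Suc s) (weights d) e'" for m m' d e e'
    using diagonal_frames_isomorphic[OF algebra that(3) algebra that(4) dim_UNIV_eq] that
    by (simp add: iso_rel_def)
  have exists: "\<exists>m e. m \<in> ?A \<and> diagonal_frame scale m (Suc s) (weights d) e" if "d \<noteq> 0" for d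
    by (rule diagonal_product_exists[OF dim_UNIV_eq]) (use that in \<open>auto simp: weights_def\<close>)
  obtain m1 e1 where m1: "m1 \<in> ?A" "diagonal_frame scale m1 (Suc s) (weights 1) e1"
    using exists[of 1] by auto
  show ?thesis
  proof (intro conjI impI)
    assume "even (n - 1)"
    then have "odd s" by (simp add: n)
    obtain v :: 'f where v: "\<And>t. v \<noteq> t\<^sup>2" using nonsquare_exists[OF odd_CARD] by blast
    with exists[of v] obtain m2 e2 where m2: "m2 \<in> ?A" "diagonal_frame scale m2 (Suc s) (weights v) e2"
      by (metis zero_power2)
    have "\<not> algebra_isomorphic scale m1 m2"
      by (rule not_isomorphic_if_even_rank[OF \<open>odd s\<close> v algebra m1(2) algebra m2(2)]) fact+
    then have not_iso: "(m1, m2) \<notin> ?R" "(m2, m1) \<notin> ?R"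
      using algebra_isomorphic_sym by (auto simp: iso_rel_def)
    have "card (?A // ?R) = card {m1, m2}"
    proof (rule card_quotient_representatives[OF R])
      show "\<exists>x\<in>{m1, m2}. (x, m) \<in> ?R" if "m \<in> ?A" for m
        using normal_frame_1_or_nonsquare[OF that v] iso m1 m2 that by blast
    qed (use m1 m2 not_iso in auto)
    also have "m1 \<noteq> m2" using not_iso R m1(1) by (auto simp: equiv_def refl_on_def)
    then have "card {m1, m2} = 2" by simp
    finally show "card (?A // ?R) = 2" .
  next
    assume "odd (n - 1)"
    then have "even s" by (simp add: n)
    have "card (?A // ?R) = card {m1}"
    proof (rule card_quotient_representatives[OF R])
      show "\<exists>x\<in>{m1}. (x, m) \<in> ?R" if "m \<in> ?A" for m
        using normal_frame_1_if_odd_rank[OF \<open>even s\<close> that] iso m1 that by blast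
    qed (use m1 in auto)
    then show "card (?A // ?R) = 1" by simp
  qed
qed

end
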